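(* Let $\mathcal{T}$ be a t-norm, let $R$ be a fuzzy $\mathcal{T}$-equivalence on a set $U$ with membership function $\mu_R\colon U^2\to[0,1]$, and let $S=\{(x,y)\in U^2\mid\mu_R(x,y)>0\}$ be the support of $R$. Let $A$ be a (crisp) subset of $U$. Then $$\mu_{[A]_R}(x)=\mu_{[A]^R}(x)\ \text{ for all } x\in U\quad\Longleftrightarrow\quad A_S=A^S.$$
   Context: A t-norm is a commutative, associative mapping $\mathcal{T}\colon[0,1]^2\to[0,1]$, increasing (order-preserving) in each argument, with $\mathcal{T}(1,x)=\mathcal{T}(x,1)=x$ for all $x\in[0,1]$. A fuzzy relation $R$ on $U$ is given by a map $\mu_R\colon U^2\to[0,1]$. It is a fuzzy $\mathcal{T}$-equivalence if $\mu_R(x,x)=1$, $\mu_R(x,y)=\mu_R(y,x)$ and $\mathcal{T}(\mu_R(x,y),\mu_R(y,z))\leq\mu_R(x,z)$ for all $x,y,z\in U$. For a crisp set $A\subseteq U$, define $\mu_{[A]_R},\mu_{[A]^R}\colon U\to[0,1]$ by $\mu_{[A]_R}(x)=\inf\{1-\mu_R(x,y)\mid y\in U,\ y\notin A\}$ and $\mu_{[A]^R}(x)=\sup\{\mu_R(x,y)\mid y\in A\}$, with the conventions $\inf\emptyset=1$, $\sup\emptyset=0$. For $x\in U$ let $S(x)=\{y\in U\mid(x,y)\in S\}$, and put $A_S=\{x\in U\mid S(x)\subseteq A\}$ and $A^S=\{x\in U\mid S(x)\cap A\neq\emptyset\}$. *)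

theory Defs
  imports Complex_Main
begin

text \<open>Fuzzy sets and relations on a carrier \<open>U\<close> are total functions into the reals; only
  their values on \<open>U\<close> (and those of a t-norm on the unit interval) are constrained or used.\<close>

definition t_norm :: "(real \<Rightarrow> real \<Rightarrow> real) \<Rightarrow> bool" where
  "t_norm T \<longleftrightarrow>
     (\<forall>x\<in>{0..1}. \<forall>y\<in>{0..1}. T x y \<in> {0..1}) \<and>
     (\<forall>x\<in>{0..1}. \<forall>y\<in>{0..1}. T x y = T y x) \<and>
     (\<forall>x\<in>{0..1}. \<forall>y\<in>{0..1}. \<forall>z\<in>{0..1}. T (T x y) z = T x (T y z)) \<and>
     (\<forall>x\<in>{0..1}. \<forall>x'\<in>{0..1}. \<forall>y\<in>{0..1}. x \<le> x' \<longrightarrow> T x y \<le> T x' y) \<and>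
     (\<forall>x\<in>{0..1}. \<forall>y\<in>{0..1}. \<forall>y'\<in>{0..1}. y \<le> y' \<longrightarrow> T x y \<le> T x y') \<and>
     (\<forall>x\<in>{0..1}. T 1 x = x \<and> T x 1 = x)"

definition fuzzy_relation_on :: "'a set \<Rightarrow> ('a \<Rightarrow> 'a \<Rightarrow> real) \<Rightarrow> bool" where
  "fuzzy_relation_on U \<mu> \<longleftrightarrow> (\<forall>x\<in>U. \<forall>y\<in>U. \<mu> x y \<in> {0..1})"

definition fuzzy_equivalence_on ::
    "(real \<Rightarrow> real \<Rightarrow> real) \<Rightarrow> 'a set \<Rightarrow> ('a \<Rightarrow> 'a \<Rightarrow> real) \<Rightarrow> bool" where
  "fuzzy_equivalence_on T U \<mu> \<longleftrightarrow>
     fuzzy_relation_on U \<mu> \<and>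
     (\<forall>x\<in>U. \<mu> x x = 1) \<and>
     (\<forall>x\<in>U. \<forall>y\<in>U. \<mu> x y = \<mu> y x) \<and>
     (\<forall>x\<in>U. \<forall>y\<in>U. \<forall>z\<in>U. T (\<mu> x y) (\<mu> y z) \<le> \<mu> x z)"

text \<open>Infima and suprema are those of the unit interval. On the type of reals \<open>Inf {}\<close> and
  \<open>Sup {}\<close> have no useful value, hence the explicit case for the empty set.\<close>

definition unit_Inf :: "real set \<Rightarrow> real" where
  "unit_Inf X = (if X = {} then 1 else Inf X)"

definition unit_Sup :: "real set \<Rightarrow> real" where
  "unit_Sup X = (if X = {} then 0 else Sup X)"

definition fuzzy_lower :: "'a set \<Rightarrow> ('a \<Rightarrow> 'a \<Rightarrow> real) \<Rightarrow> 'a set \<Rightarrow> 'a \<Rightarrow> real" where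
  "fuzzy_lower U \<mu> A x = unit_Inf {1 - \<mu> x y | y. y \<in> U \<and> y \<notin> A}"

definition fuzzy_upper :: "('a \<Rightarrow> 'a \<Rightarrow> real) \<Rightarrow> 'a set \<Rightarrow> 'a \<Rightarrow> real" where
  "fuzzy_upper \<mu> A x = unit_Sup {\<mu> x y | y. y \<in> A}"

definition fuzzy_support :: "'a set \<Rightarrow> ('a \<Rightarrow> 'a \<Rightarrow> real) \<Rightarrow> ('a \<times> 'a) set" where
  "fuzzy_support U \<mu> = {(x, y). x \<in> U \<and> y \<in> U \<and> \<mu> x y > 0}"

definition neighborhood :: "'a set \<Rightarrow> ('a \<times> 'a) set \<Rightarrow> 'a \<Rightarrow> 'a set" where
  "neighborhood U S x = {y \<in> U. (x, y) \<in> S}"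

definition lower_approx :: "'a set \<Rightarrow> ('a \<times> 'a) set \<Rightarrow> 'a set \<Rightarrow> 'a set" where
  "lower_approx U S A = {x \<in> U. neighborhood U S x \<subseteq> A}"

definition upper_approx :: "'a set \<Rightarrow> ('a \<times> 'a) set \<Rightarrow> 'a set \<Rightarrow> 'a set" where
  "upper_approx U S A = {x \<in> U. neighborhood U S x \<inter> A \<noteq> {}}"

end

theory Submission
  imports Defs
begin

text \<open>Both sides say that \<open>\<mu>\<close> vanishes on \<open>A \<times> (U - A)\<close>. At a point of \<open>A\<close> the
  fuzzy upper approximation is 1, and the lower one is 1 only if no point outside \<open>A\<close> is
  related to it; by symmetry the same vanishing makes both approximations 0 outside \<open>A\<close>.
  Likewise \<open>A \<subseteq> A\<^sup>S = A\<^sub>S\<close> says that no point of \<open>A\<close> is related to one outside.\<close>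

lemma unit_Inf_eq_0:
  assumes "X \<subseteq> {0..1}" and "0 \<in> X"
  shows "unit_Inf X = 0"
proof -
  have "Inf X = 0"
    using assms by (intro cInf_eq_minimum) auto
  then show ?thesis
    using assms(2) by (auto simp: unit_Inf_def)
qed

text \<open>Since 1 is the top of the unit interval, an infimum of 1 leaves room for no other
  element. The empty set fits in because its infimum is set to 1.\<close>

lemma unit_Inf_eq_1_iff:
  assumes "X \<subseteq> {0..1}"
  shows "unit_Inf X = 1 \<longleftrightarrow> X \<subseteq> {1}"
proof
  assume Inf: "unit_Inf X = 1"
  show "X \<subseteq> {1}"
  proof
    fix t assume t: "t \<in> X"
    moreover have "bdd_below X"
      using assms by (intro bdd_belowI[of _ 0]) auto
    ultimately have "Inf X \<le> t"
      by (rule cInf_lower)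
    \<comment> \<open>The element \<open>t\<close> rules out the default value for the empty set, so
      \<open>unit_Inf X\<close> is the genuine infimum.\<close>
    moreover have "Inf X = 1"
      using Inf t by (auto simp: unit_Inf_def split: if_splits)
    ultimately show "t \<in> {1}"
      using assms t by force
  qed
next
  assume "X \<subseteq> {1}"
  then have "X = {} \<or> X = {1}"
    by blast
  then show "unit_Inf X = 1"
    by (auto simp: unit_Inf_def)
qed

lemma unit_Sup_eq_1:
  assumes "X \<subseteq> {0..1}" and "1 \<in> X"
  shows "unit_Sup X = 1"
proof -
  have "Sup X = 1"
    using assms by (intro cSup_eq_maximum) auto
  then show ?thesis
    using assms(2) by (auto simp: unit_Sup_def)
qed

lemma unit_Sup_eq_0:
  assumes "X \<subseteq> {0}"
  shows "unit_Sup X = 0"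
proof -
  have "X = {} \<or> X = {0}"
    using assms by blast
  then show ?thesis
    by (auto simp: unit_Sup_def)
qed

lemma fuzzy_lower_eq_1_iff:
  assumes "fuzzy_relation_on U \<mu>" and "x \<in> U"
  shows "fuzzy_lower U \<mu> A x = 1 \<longleftrightarrow> (\<forall>y\<in>U - A. \<mu> x y = 0)"
proof -
  have "{1 - \<mu> x y | y. y \<in> U \<and> y \<notin> A} \<subseteq> {0..1}"
    using assms by (auto simp: fuzzy_relation_on_def)
  then show ?thesis
    unfolding fuzzy_lower_def by (subst unit_Inf_eq_1_iff) auto
qed

text \<open>The point \<open>x\<close> is itself outside \<open>A\<close>, so y = x contributes 1 -
  1 = 0, the least possible value.\<close>

lemma fuzzy_lower_eq_0:
  assumes "fuzzy_relation_on U \<mu>" and "x \<in> U - A" and "\<mu> x x = 1"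
  shows "fuzzy_lower U \<mu> A x = 0"
  unfolding fuzzy_lower_def
proof (rule unit_Inf_eq_0)
  show "{1 - \<mu> x y | y. y \<in> U \<and> y \<notin> A} \<subseteq> {0..1}"
    using assms by (auto simp: fuzzy_relation_on_def)
  show "0 \<in> {1 - \<mu> x y | y. y \<in> U \<and> y \<notin> A}"
    using assms by force
qed

lemma fuzzy_upper_eq_1:
  assumes "fuzzy_relation_on U \<mu>" and "A \<subseteq> U" and "x \<in> A" and "\<mu> x x = 1"
  shows "fuzzy_upper \<mu> A x = 1"
  unfolding fuzzy_upper_def
proof (rule unit_Sup_eq_1)
  show "{\<mu> x y | y. y \<in> A} \<subseteq> {0..1}"
    using assms by (auto simp: fuzzy_relation_on_def subset_iff)
  show "1 \<in> {\<mu> x y | y. y \<in> A}"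
    using assms by force
qed

text \<open>For empty \<open>A\<close> this rests on the default supremum 0.\<close>

lemma fuzzy_upper_eq_0:
  assumes "\<And>y. y \<in> A \<Longrightarrow> \<mu> x y = 0"
  shows "fuzzy_upper \<mu> A x = 0"
  unfolding fuzzy_upper_def by (rule unit_Sup_eq_0) (auto simp: assms)

lemma fuzzy_lower_eq_upper_iff:
  assumes rel: "fuzzy_relation_on U \<mu>"
    and refl: "\<And>x. x \<in> U \<Longrightarrow> \<mu> x x = 1"
    and sym: "\<And>x y. x \<in> U \<Longrightarrow> y \<in> U \<Longrightarrow> \<mu> x y = \<mu> y x"
    and "A \<subseteq> U"
  shows "(\<forall>x\<in>U. fuzzy_lower U \<mu> A x = fuzzy_upper \<mu> A x) \<longleftrightarrow>
         (\<forall>x\<in>A. \<forall>y\<in>U - A. \<mu> x y = 0)"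
proof
  assume eq: "\<forall>x\<in>U. fuzzy_lower U \<mu> A x = fuzzy_upper \<mu> A x"
  show "\<forall>x\<in>A. \<forall>y\<in>U - A. \<mu> x y = 0"
  proof
    fix x assume x: "x \<in> A"
    then have "x \<in> U"
      using \<open>A \<subseteq> U\<close> by blast
    \<comment> \<open>Equality of the approximations carries this 1 over to the lower one, where it
      forces \<mu> to vanish.\<close>
    moreover have "fuzzy_upper \<mu> A x = 1"
      using rel \<open>A \<subseteq> U\<close> x refl[OF \<open>x \<in> U\<close>] by (rule fuzzy_upper_eq_1)
    ultimately show "\<forall>y\<in>U - A. \<mu> x y = 0"
      using eq fuzzy_lower_eq_1_iff[OF rel] by metis
  qed
next
  assume sep: "\<forall>x\<in>A. \<forall>y\<in>U - A. \<mu> x y = 0"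
  show "\<forall>x\<in>U. fuzzy_lower U \<mu> A x = fuzzy_upper \<mu> A x"
  proof
    fix x assume x: "x \<in> U"
    show "fuzzy_lower U \<mu> A x = fuzzy_upper \<mu> A x"
    proof (cases "x \<in> A")
      case True
      then have "fuzzy_lower U \<mu> A x = 1"
        using sep fuzzy_lower_eq_1_iff[OF rel x] by blast
      then show ?thesis
        using fuzzy_upper_eq_1[OF rel \<open>A \<subseteq> U\<close> True refl[OF x]] by simp
    next
      case False
      then have "fuzzy_lower U \<mu> A x = 0"
        using rel x refl by (intro fuzzy_lower_eq_0) auto
      moreover have "fuzzy_upper \<mu> A x = 0"
      \<comment> \<open>The separation hypothesis has its first argument in \<open>A\<close>;
        symmetry turns it around for \<open>x\<close> outside \<open>A\<close>.\<close>
      proof (rule fuzzy_upper_eq_0)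
        fix y assume y: "y \<in> A"
        then have "\<mu> y x = 0"
          using sep x False by blast
        moreover have "y \<in> U"
          using y \<open>A \<subseteq> U\<close> by blast
        ultimately show "\<mu> x y = 0"
          using sym x by simp
      qed
      ultimately show ?thesis
        by simp
    qed
  qed
qed

text \<open>Crisp counterpart of the previous lemma: reflexivity gives
  \<open>lower_approx U S A\<close> \<subseteq> \<open>A\<close> \<subseteq>
  \<open>upper_approx U S A\<close>, and separation collapses this chain.\<close>

lemma lower_approx_eq_upper_approx_iff:
  assumes refl: "\<And>x. x \<in> U \<Longrightarrow> (x, x) \<in> S"
    and sym: "\<And>x y. (x, y) \<in> S \<Longrightarrow> (y, x) \<in> S"
    and "A \<subseteq> U"
  shows "lower_approx U S A = upper_approx U S A \<longleftrightarrow>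
         (\<forall>x\<in>A. \<forall>y\<in>U - A. (x, y) \<notin> S)"
proof
  assume eq: "lower_approx U S A = upper_approx U S A"
  have "A \<subseteq> upper_approx U S A"
    using refl \<open>A \<subseteq> U\<close> by (auto simp: upper_approx_def neighborhood_def)
  then have "A \<subseteq> lower_approx U S A"
    using eq by simp
  then show "\<forall>x\<in>A. \<forall>y\<in>U - A. (x, y) \<notin> S"
    by (auto simp: lower_approx_def neighborhood_def)
next
  assume sep: "\<forall>x\<in>A. \<forall>y\<in>U - A. (x, y) \<notin> S"
  have "lower_approx U S A = A"
    using sep refl \<open>A \<subseteq> U\<close> by (auto simp: lower_approx_def neighborhood_def)
  moreover have "upper_approx U S A = A"
  proof
    \<comment> \<open>A point outside \<open>A\<close> with a neighbor in \<open>A\<close> would, by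
      symmetry, be related to from inside \<open>A\<close>.\<close>
    show "upper_approx U S A \<subseteq> A"
      using sep sym by (auto simp: upper_approx_def neighborhood_def)
    show "A \<subseteq> upper_approx U S A"
      using refl \<open>A \<subseteq> U\<close> by (auto simp: upper_approx_def neighborhood_def)
  qed
  ultimately show "lower_approx U S A = upper_approx U S A"
    by simp
qed

theorem proposition2:
  fixes T :: "real \<Rightarrow> real \<Rightarrow> real"
    and U A :: "'a set"
    and \<mu> :: "'a \<Rightarrow> 'a \<Rightarrow> real"
    and S :: "('a \<times> 'a) set"
  assumes "t_norm T"
    and "fuzzy_equivalence_on T U \<mu>"
    and "S = fuzzy_support U \<mu>"
    and "A \<subseteq> U"
  shows "(\<forall>x\<in>U. fuzzy_lower U \<mu> A x = fuzzy_upper \<mu> A x) \<longleftrightarrow>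
         lower_approx U S A = upper_approx U S A"
proof -
  have rel: "fuzzy_relation_on U \<mu>"
    and refl: "\<And>x. x \<in> U \<Longrightarrow> \<mu> x x = 1"
    and sym: "\<And>x y. x \<in> U \<Longrightarrow> y \<in> U \<Longrightarrow> \<mu> x y = \<mu> y x"
    using assms(2) by (auto simp: fuzzy_equivalence_on_def)
  \<comment> \<open>Membership values are nonnegative, so positive means nonzero; this makes the
    crisp and the fuzzy separation conditions the same.\<close>
  have S: "(x, y) \<in> S \<longleftrightarrow> \<mu> x y \<noteq> 0" if "x \<in> U" "y \<in> U" for x y
    using rel that assms(3) by (force simp: fuzzy_support_def fuzzy_relation_on_def)
  have "lower_approx U S A = upper_approx U S A \<longleftrightarrow> (\<forall>x\<in>A. \<forall>y\<in>U - A. (x, y) \<notin> S)"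
  proof (rule lower_approx_eq_upper_approx_iff)
    show "(x, x) \<in> S" if "x \<in> U" for x
      using that refl S by simp
    show "(y, x) \<in> S" if "(x, y) \<in> S" for x y
      using that sym assms(3) by (auto simp: fuzzy_support_def)
  qed (rule assms(4))
  also have "\<dots> \<longleftrightarrow> (\<forall>x\<in>A. \<forall>y\<in>U - A. \<mu> x y = 0)"
    using S assms(4) by blast
  finally show ?thesis
    using fuzzy_lower_eq_upper_iff[OF rel refl sym assms(4)] by simp
qed

end
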